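(* The Only Upper Bounded Days On Days Off Scheduling Problem (UDODOSP) can be decided in $\mathcal{O}(D^2)$ time.
   Context: An instance of the Days On Days Off Scheduling Problem (DODOSP) consists of integers $D\ge 1$ (days), $N\ge 1$ (workers), bounds $l_w,u_w,l_o,u_o,U_w,U_o\in\mathbb{N}$, and for each day $d\in\{1,\dots,D\}$ integers $0\le r_l^d\le r_u^d\le N$. A schedule is a map $f:\{n_1,\dots,n_N\}\times\{1,\dots,D\}\to\{\mathrm{ON},\mathrm{OFF}\}$ (not cyclic). A work period (resp. off period) of a worker is an inclusion-wise maximal set of consecutive days on which the worker is ON (resp. OFF). A schedule is feasible if on every day $d$ the number of workers that are ON lies in $[r_l^d,r_u^d]$, every work period has length between $l_w$ and $u_w$, every off period has length between $l_o$ and $u_o$, every worker is ON on at most $U_w$ days and OFF on at most $U_o$ days. The decision problem asks whether a feasible schedule exists. The UDODOSP is the DODOSP restricted to instances with $l_w=l_o=1$. *)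

theory Defs
  imports Main
begin

record dodosp_inst =
  days :: nat
  workers :: nat
  lw :: nat
  uw :: nat
  lo :: nat
  uo :: nat
  Uw :: nat
  Uo :: nat
  rl :: "nat \<Rightarrow> nat"   (* lower requirement r_l^d, for d in {1..D} *)
  ru :: "nat \<Rightarrow> nat"   (* upper requirement r_u^d, for d in {1..D} *)

definition valid_inst :: "dodosp_inst \<Rightarrow> bool" where
  "valid_inst I \<longleftrightarrow> days I \<ge> 1 \<and> workers I \<ge> 1 \<and>
     (\<forall>d\<in>{1..days I}. rl I d \<le> ru I d \<and> ru I d \<le> workers I)"

definition udodosp_inst :: "dodosp_inst \<Rightarrow> bool" where
  "udodosp_inst I \<longleftrightarrow> valid_inst I \<and> lw I = 1 \<and> lo I = 1"

text \<open>A schedule: workers are 0..N-1, days are 1..D; True means ON, False means OFF.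
  Values outside this range are irrelevant.\<close>
type_synonym schedule = "nat \<Rightarrow> nat \<Rightarrow> bool"

definition is_period :: "nat \<Rightarrow> schedule \<Rightarrow> nat \<Rightarrow> bool \<Rightarrow> nat \<Rightarrow> nat \<Rightarrow> bool" where
  "is_period D f i s a b \<longleftrightarrow> 1 \<le> a \<and> a \<le> b \<and> b \<le> D \<and>
     (\<forall>d\<in>{a..b}. f i d = s) \<and>
     (a = 1 \<or> f i (a - 1) \<noteq> s) \<and> (b = D \<or> f i (b + 1) \<noteq> s)"

definition feasible :: "dodosp_inst \<Rightarrow> schedule \<Rightarrow> bool" where
  "feasible I f \<longleftrightarrow>
     (\<forall>d\<in>{1..days I}. rl I d \<le> card {i. i < workers I \<and> f i d} \<and>
                        card {i. i < workers I \<and> f i d} \<le> ru I d) \<and>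
     (\<forall>i<workers I. \<forall>a b. is_period (days I) f i True a b \<longrightarrow>
                        lw I \<le> b + 1 - a \<and> b + 1 - a \<le> uw I) \<and>
     (\<forall>i<workers I. \<forall>a b. is_period (days I) f i False a b \<longrightarrow>
                        lo I \<le> b + 1 - a \<and> b + 1 - a \<le> uo I) \<and>
     (\<forall>i<workers I. card {d\<in>{1..days I}. f i d} \<le> Uw I \<and>
                    card {d\<in>{1..days I}. \<not> f i d} \<le> Uo I)"

definition has_feasible_schedule :: "dodosp_inst \<Rightarrow> bool" where
  "has_feasible_schedule I \<longleftrightarrow> (\<exists>f. feasible I f)"

datatype instr =
    LoadC nat int
  | Add nat nat nat
  | Sub nat nat nat
  | LoadI nat nat
  | StoreI nat nat
  | Jmp nat
  | Jlez nat nat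
  | Halt

type_synonym config = "nat \<times> (nat \<Rightarrow> int)"

definition halted :: "instr list \<Rightarrow> config \<Rightarrow> bool" where
  "halted P c \<longleftrightarrow> fst c \<ge> length P \<or> P ! fst c = Halt"

fun exec_instr :: "instr \<Rightarrow> config \<Rightarrow> config" where
  "exec_instr (LoadC r k) (pc, m) = (Suc pc, m(r := k))"
| "exec_instr (Add r a b) (pc, m) = (Suc pc, m(r := m a + m b))"
| "exec_instr (Sub r a b) (pc, m) = (Suc pc, m(r := m a - m b))"
| "exec_instr (LoadI r a) (pc, m) = (Suc pc, m(r := m (nat (m a))))"
| "exec_instr (StoreI a b) (pc, m) = (Suc pc, m(nat (m a) := m b))"
| "exec_instr (Jmp t) (pc, m) = (t, m)"
| "exec_instr (Jlez r t) (pc, m) = (if m r \<le> 0 then t else Suc pc, m)"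
| "exec_instr Halt (pc, m) = (pc, m)"

definition step :: "instr list \<Rightarrow> config \<Rightarrow> config" where
  "step P c = (if halted P c then c else exec_instr (P ! fst c) c)"

definition exec :: "instr list \<Rightarrow> nat \<Rightarrow> config \<Rightarrow> config" where
  "exec P t c = (step P ^^ t) c"

text \<open>Input encoding: cells 0..7 hold D, N, l_w, u_w, l_o, u_o, U_w, U_o; for day
  d \<in> {1..D}, cell 6 + 2d holds r_l^d and cell 7 + 2d holds r_u^d; all other cells are 0.\<close>
definition encode :: "dodosp_inst \<Rightarrow> nat \<Rightarrow> int" where
  "encode I k =
     (if k = 0 then int (days I) else if k = 1 then int (workers I)
      else if k = 2 then int (lw I) else if k = 3 then int (uw I)
      else if k = 4 then int (lo I) else if k = 5 then int (uo I)
      else if k = 6 then int (Uw I) else if k = 7 then int (Uo I)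
      else if k < 8 + 2 * days I then
        (if even k then int (rl I ((k - 6) div 2)) else int (ru I ((k - 7) div 2)))
      else 0)"

definition decides_within ::
  "instr list \<Rightarrow> (dodosp_inst \<Rightarrow> bool) \<Rightarrow> (dodosp_inst \<Rightarrow> bool) \<Rightarrow> (dodosp_inst \<Rightarrow> nat) \<Rightarrow> bool" where
  "decides_within P A Q T \<longleftrightarrow>
     (\<forall>I. A I \<longrightarrow> (\<exists>t\<le>T I. halted P (exec P t (0, encode I)) \<and>
                    snd (exec P t (0, encode I)) 0 = (if Q I then 1 else 0)))"

end

(* Let X d be the total number of shifts worked up to day d. If the bounds on the daily numbers
   of workers hold, the shifts can be handed out to the workers in cyclic order, and then any
   two workers differ by at most one shift on each interval of days. Hence a feasible schedule
   exists iff every interval of u_w + 1 days has at most N u_w shifts, every interval of u_o + 1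
   days at least N shifts, and the total lies between N (D - U_o) and N U_w. These are O(D)
   difference constraints on the D + 1 integers X 0, ..., X D, which Bellman-Ford decides in
   O(D) rounds of O(D) steps; N enters only through products with factors at most D, which are
   computed by repeated addition. *)

theory Submission
  imports Defs
begin

section \<open>In-place Bellman--Ford for difference constraints\<close>

text \<open>The time may depend on D alone, while N, u_w, u_o, U_w, U_o are unbounded and the
  machine only adds and subtracts. So no loop may be governed by these numbers, and the factors of N
  are clipped to at most D. This loses nothing: a window longer than the horizon gives no
  constraint, and a worker has at most D shifts. The cyclic order works because at most N shifts a
  day give nobody two shifts on one day, and because balance turns a bound N k on the total of an
  interval into the bound k for every worker. As l_w = l_o = 1, a period is never too short.
  All-zero initial potentials take the place of a source vertex.\<close>

type_synonym edge = "nat \<times> nat \<times> int"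

definition sat :: "edge list \<Rightarrow> (nat \<Rightarrow> int) \<Rightarrow> bool" where
  "sat es X \<longleftrightarrow> (\<forall>(u, v, w)\<in>set es. X v \<le> X u + w)"

fun relax :: "edge \<Rightarrow> (nat \<Rightarrow> int) \<times> bool \<Rightarrow> (nat \<Rightarrow> int) \<times> bool" where
  "relax (u, v, w) (X, f) = (if X u + w < X v then (X(v := X u + w), True) else (X, f))"

definition bf_round :: "edge list \<Rightarrow> (nat \<Rightarrow> int) \<times> bool \<Rightarrow> (nat \<Rightarrow> int) \<times> bool" where
  "bf_round es s = fold relax es (fst s, False)"

lemma fold_relax_le: "fst (fold relax es s) x \<le> fst s x"
proof (induction es arbitrary: s)
  case (Cons e es)
  have "fst (relax e s) x \<le> fst s x" by (cases e; cases s) auto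
  with Cons.IH[of "relax e s"] show ?case by simp
qed simp

text \<open>A solution below the potentials is a barrier: the new value \<open>X u + w\<close> is at
  least \<open>Z u + w\<close>, hence at least \<open>Z v\<close>.\<close>

lemma fold_relax_ge:
  assumes "sat es Z" "\<forall>x. Z x \<le> fst s x"
  shows "Z x \<le> fst (fold relax es s) x"
  using assms
proof (induction es arbitrary: s)
  case (Cons e es)
  obtain u v w X f where [simp]: "e = (u, v, w)" "s = (X, f)" by (cases e; cases s) auto
  have "Z v \<le> Z u + w" "Z u \<le> X u" using Cons.prems by (auto simp: sat_def)
  hence "Z v \<le> X u + w" by linarith
  hence "\<forall>x. Z x \<le> fst (relax e s) x" using Cons.prems by auto
  with Cons show ?case by (simp add: sat_def)
qed simp

text \<open>Why updating in place does no harm: potentials only fall, so when the edge is relaxed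
  \<open>u\<close> has at most its initial value, and \<open>v\<close> never rises
  afterwards.\<close>

lemma fold_relax_edge:
  assumes "(u, v, w) \<in> set es"
  shows "fst (fold relax es s) v \<le> fst s u + w"
  using assms
proof (induction es arbitrary: s)
  case (Cons e es)
  show ?case
  proof (cases "e = (u, v, w)")
    case True
    have "fst (fold relax (e # es) s) v \<le> fst (relax e s) v" by (simp add: fold_relax_le)
    also have "\<dots> \<le> fst s u + w" using True by (cases s) auto
    finally show ?thesis .
  next
    case False
    hence "fst (fold relax es (relax e s)) v \<le> fst (relax e s) u + w" using Cons by auto
    also have "fst (relax e s) u \<le> fst s u" using fold_relax_le[of "[e]"] by simp
    finally show ?thesis by simp
  qed
qed simp

lemma relax_flag: "snd s \<Longrightarrow> snd (fold relax es s)"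
proof (induction es arbitrary: s)
  case (Cons e es)
  have "snd (relax e s)" using Cons.prems by (cases e; cases s) auto
  with Cons show ?case by simp
qed simp

text \<open>As long as nothing changes, every edge is tested against the initial \<open>X\<close>,
  so the first violated edge is noticed.\<close>

lemma fold_relax_flag: "snd (fold relax es (X, False)) \<longleftrightarrow> \<not> sat es X"
proof (induction es arbitrary: X)
  case (Cons e es)
  obtain u v w where [simp]: "e = (u, v, w)" by (cases e)
  show ?case using Cons relax_flag[of "(X(v := X u + w), True)" es] by (auto simp: sat_def)
qed (simp add: sat_def)

text \<open>No paths or negative cycles are considered. The potentials fall from 0 but never below a
  nonpositive solution. For such a solution \<open>Z\<close> of largest sum, every round lets at
  least one further vertex reach its value in \<open>Z\<close>, so \<open>card V\<close> rounds
  suffice.\<close>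

lemma bellman_ford_stable:
  assumes fin: "finite V" and V: "\<forall>(u, v, w)\<in>set es. u \<in> V \<and> v \<in> V"
    and Y: "sat es Y" and n: "card V \<le> n"
  shows "sat es (fst ((bf_round es ^^ n) (\<lambda>_. 0, f)))"
proof -
  define ok where "ok Z \<longleftrightarrow> sat es Z \<and> (\<forall>x. Z x \<le> 0) \<and> (\<forall>x. x \<notin> V \<longrightarrow> Z x = 0)" for Z
  \<comment> \<open>Translation preserves all constraints; subtracting the maximum puts the solution
    below the all-zero start.\<close>
  have "ok (\<lambda>x. if x \<in> V then Y x - Max (Y ` V) else 0)"
    using Y V fin by (fastforce simp: ok_def sat_def)
  \<comment> \<open>A largest sum over \<open>V\<close>, phrased as a least natural number; the sums
    are nonpositive.\<close>
  then obtain Z where "ok Z" and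
    min: "\<And>Z'. ok Z' \<Longrightarrow> nat (- (\<Sum>x\<in>V. Z x)) \<le> nat (- (\<Sum>x\<in>V. Z' x))"
    using ex_has_least_nat[of ok _ "\<lambda>Z. nat (- (\<Sum>x\<in>V. Z x))"] by blast
  hence Z: "sat es Z" "\<And>x. Z x \<le> 0" "\<And>x. x \<notin> V \<Longrightarrow> Z x = 0" by (auto simp: ok_def)
  define X where "X n = fst ((bf_round es ^^ n) (\<lambda>_. 0, f))" for n
  have X_Suc: "X (Suc n) = fst (fold relax es (X n, False))" for n
    by (simp add: X_def bf_round_def)
  have anti: "X (Suc n) x \<le> X n x" for n x
    using fold_relax_le[of es "(X n, False)"] by (simp add: X_Suc)
  have X0: "X n x \<le> 0" for n x
    by (induction n) (auto simp: X_def[of 0] intro: order.trans[OF anti])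
  have ge: "\<forall>x. Z x \<le> X n x" for n
  proof (induction n)
    case (Suc n)
    thus ?case using fold_relax_ge[OF Z(1), of "(X n, False)"] by (simp add: X_Suc)
  qed (simp add: X_def Z)
  define T where "T n = {x \<in> V. X n x = Z x}" for n
  have T_mono: "T n \<subseteq> T (Suc n)" for n
  proof
    fix x assume "x \<in> T n"
    thus "x \<in> T (Suc n)"
      using anti[of n x] ge[rule_format, of x "Suc n"] by (simp add: T_def)
  qed
  \<comment> \<open>If no further vertex becomes tight, the solution \<open>Z\<close> can be raised by 1 at all vertices
    that are not tight.\<close>
  have grow: "T n \<subset> T (Suc n)" if "T n \<noteq> V" for n
  proof (rule ccontr)
    assume "\<not> T n \<subset> T (Suc n)"
    with T_mono have eq: "T (Suc n) = T n" by blast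
    define W where "W = V - T n"
    have W: "W \<noteq> {}" "W \<subseteq> V" using that by (auto simp: W_def T_def)
    define Z' where "Z' x = Z x + (if x \<in> W then 1 else 0)" for x
    have lt: "Z x < X (Suc n) x" if "x \<in> W" for x
    proof -
      have "x \<in> V" "x \<notin> T (Suc n)" using that eq by (auto simp: W_def)
      thus ?thesis using ge[rule_format, of x "Suc n"] by (simp add: T_def)
    qed
    have le: "Z' x \<le> 0" for x
      using lt[of x] X0[of "Suc n" x] Z(2)[of x] by (auto simp: Z'_def)
    have "Z' v \<le> Z' u + w" if e: "(u, v, w) \<in> set es" for u v w
    proof (cases "v \<in> W \<and> u \<notin> W")
      case True
      \<comment> \<open>Since \<open>u\<close> was tight before the round,
        \<open>Z v < X (Suc n) v \<le> Z u + w\<close>; by integrality there is room to raise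
        \<open>Z v\<close> by 1.\<close>
      hence "X n u = Z u" using e V by (auto simp: W_def T_def)
      moreover have "X (Suc n) v \<le> X n u + w"
        using fold_relax_edge[OF e, of "(X n, False)"] by (simp add: X_Suc)
      ultimately show ?thesis using lt[of v] True by (simp add: Z'_def)
    next
      case False
      have "Z v \<le> Z u + w" using Z(1) e by (auto simp: sat_def)
      thus ?thesis using False by (auto simp: Z'_def)
    qed
    hence "ok Z'" using le Z W by (auto simp: ok_def sat_def Z'_def)
    hence "nat (- (\<Sum>x\<in>V. Z x)) \<le> nat (- (\<Sum>x\<in>V. Z' x))" by (rule min)
    moreover have "(\<Sum>x\<in>V. Z x) < (\<Sum>x\<in>V. Z' x)"
      using W by (intro sum_strict_mono_ex1[OF fin]) (auto simp: Z'_def)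
    moreover have "(\<Sum>x\<in>V. Z' x) \<le> 0" using le by (simp add: sum_nonpos)
    ultimately show False by linarith
  qed
  have T_V: "T n \<subseteq> V" and fT: "finite (T n)" for n using fin by (auto simp: T_def)
  have "T n = V \<or> n \<le> card (T n)" for n
  proof (induction n)
    case (Suc n)
    show ?case
    proof (cases "T n = V")
      case True
      thus ?thesis using T_mono[of n] T_V[of "Suc n"] by auto
    next
      case False
      thus ?thesis using Suc psubset_card_mono[OF fT grow[OF False]] by auto
    qed
  qed simp
  hence "T n = V \<or> n \<le> card (T n)" .
  hence "T n = V" using n card_seteq[OF fin T_V, of n] by linarith
  hence "X n x = Z x" if "x \<in> V" for x using that by (auto simp: T_def)
  thus ?thesis using Z(1) V by (auto 0 4 simp: sat_def X_def)
qed

text \<open>Every round clears the flag, so it reports on the last round alone. If there is a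
  solution, the first \<open>n - 1\<close> rounds reach one and the last changes nothing; otherwise
  every round finds a violated edge.\<close>

theorem bellman_ford:
  assumes "finite V" and "\<forall>(u, v, w)\<in>set es. u \<in> V \<and> v \<in> V" and "card V < n"
  shows "snd ((bf_round es ^^ n) (\<lambda>_. 0, f)) \<longleftrightarrow> \<not> (\<exists>X. sat es X)"
proof -
  obtain k where n: "n = Suc k" "card V \<le> k" using assms(3) by (cases n) auto
  have "snd ((bf_round es ^^ n) (\<lambda>_. 0, f)) \<longleftrightarrow> \<not> sat es (fst ((bf_round es ^^ k) (\<lambda>_. 0, f)))"
    by (simp add: n bf_round_def fold_relax_flag)
  thus ?thesis using bellman_ford_stable[OF assms(1,2) _ n(2)] by blast
qed

section \<open>Feasible schedules and difference constraints\<close>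

text \<open>An edge \<open>(u, v, w)\<close> stands for \<open>X v \<le> X u + w\<close>, so lower
  bounds become edges backwards in time with negated weight. The \<open>min\<close> equals
  \<open>uw I\<close> whenever \<open>uw I < d\<close>; it is written out because the program
  computes this product once, with a clipped factor, before it looks at any day.\<close>

definition day_edges :: "dodosp_inst \<Rightarrow> nat \<Rightarrow> edge list" where
  "day_edges I d =
     [(d - 1, d, int (ru I d)), (d, d - 1, - int (rl I d))]
     @ (if uw I < d then [(d - uw I - 1, d, int (workers I * min (uw I) (days I)))] else [])
     @ (if uo I < d then [(d, d - uo I - 1, - int (workers I))] else [])"

text \<open>The days come in decreasing order because the program counts down to 0. If
  \<open>Uo I\<close> exceeds \<open>days I\<close>, truncated subtraction leaves
  \<open>X 0 \<le> X (days I)\<close>, which the daily requirements imply.\<close>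

definition edges :: "dodosp_inst \<Rightarrow> edge list" where
  "edges I = concat (map (day_edges I) (rev [1..<Suc (days I)]))
     @ [(0, days I, int (workers I * min (Uw I) (days I))),
        (days I, 0, - int (workers I * (days I - Uo I)))]"

lemma sat_edges:
  "sat (edges I) X \<longleftrightarrow>
     (\<forall>d\<in>{1..days I}. X d \<le> X (d - 1) + int (ru I d) \<and> X (d - 1) + int (rl I d) \<le> X d
        \<and> (uw I < d \<longrightarrow> X d \<le> X (d - uw I - 1) + int (workers I * uw I))
        \<and> (uo I < d \<longrightarrow> X (d - uo I - 1) + int (workers I) \<le> X d))
     \<and> X (days I) \<le> X 0 + int (workers I * min (Uw I) (days I))
     \<and> X 0 + int (workers I * (days I - Uo I)) \<le> X (days I)"
proof -
  have "sat (day_edges I d) X \<longleftrightarrow>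
      X d \<le> X (d - 1) + int (ru I d) \<and> X (d - 1) + int (rl I d) \<le> X d
        \<and> (uw I < d \<longrightarrow> X d \<le> X (d - uw I - 1) + int (workers I * uw I))
        \<and> (uo I < d \<longrightarrow> X (d - uo I - 1) + int (workers I) \<le> X d)" if "d \<in> {1..days I}" for d
    using that by (auto simp: day_edges_def sat_def min_def)
  moreover have "sat (edges I) X \<longleftrightarrow> (\<forall>d\<in>{1..days I}. sat (day_edges I d) X)
     \<and> X (days I) \<le> X 0 + int (workers I * min (Uw I) (days I))
     \<and> X 0 + int (workers I * (days I - Uo I)) \<le> X (days I)"
    by (auto simp: edges_def sat_def ball_Un atLeastLessThanSuc_atLeastAtMost simp del: upt_Suc)
  ultimately show ?thesis by auto
qed

lemma edges_vertices: "\<forall>(u, v, w)\<in>set (edges I). u \<in> {..days I} \<and> v \<in> {..days I}"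
  by (auto simp: edges_def day_edges_def simp del: upt_Suc)

section \<open>Necessity: from schedules to difference constraints\<close>

lemma run_in_period:
  assumes "1 \<le> a" "a \<le> b" "b \<le> D" "\<forall>d\<in>{a..b}. f i d = s"
  shows "\<exists>a' b'. is_period D f i s a' b' \<and> b + 1 - a \<le> b' + 1 - a'"
proof -
  let ?P = "\<lambda>x. 1 \<le> x \<and> x \<le> a \<and> (\<forall>d\<in>{x..b}. f i d = s)"
  let ?Q = "\<lambda>y. b \<le> y \<and> y \<le> D \<and> (\<forall>d\<in>{a..y}. f i d = s)"
  have P: "?P a" and Q: "?Q b" using assms by auto
  have bd: "\<And>y. ?Q y \<Longrightarrow> y \<le> D" by blast
  \<comment> \<open>\<open>feasible\<close> bounds only maximal periods, so the run is extended as
    far as possible on both sides.\<close>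
  define a' b' where "a' = (LEAST x. ?P x)" and "b' = (GREATEST y. ?Q y)"
  have a': "?P a'" "\<And>x. ?P x \<Longrightarrow> a' \<le> x"
    unfolding a'_def using LeastI[of ?P, OF P] Least_le[of ?P] by blast+
  have b': "?Q b'" "\<And>y. ?Q y \<Longrightarrow> y \<le> b'"
    unfolding b'_def using GreatestI_nat[of ?Q, OF Q bd] Greatest_le_nat[of ?Q, OF _ bd] by blast+
  have run: "\<forall>d\<in>{a'..b'}. f i d = s"
  proof
    fix d assume "d \<in> {a'..b'}"
    thus "f i d = s" using a'(1) b'(1) assms by (cases "d \<le> b") auto
  qed
  have "a' = 1 \<or> f i (a' - 1) \<noteq> s"
  proof (rule ccontr)
    assume asm: "\<not> ?thesis"
    have "f i d = s" if "a' - 1 \<le> d" "d \<le> b" for d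
      using asm a'(1) that by (cases "d = a' - 1") auto
    hence "?P (a' - 1)" using asm a'(1) by auto
    from a'(2)[OF this] a'(1) show False by linarith
  qed
  moreover have "b' = D \<or> f i (b' + 1) \<noteq> s"
  proof (rule ccontr)
    assume asm: "\<not> ?thesis"
    have "f i d = s" if "a \<le> d" "d \<le> b' + 1" for d
      using asm b'(1) that by (cases "d = b' + 1") auto
    hence "?Q (b' + 1)" using asm b'(1) by auto
    from b'(2)[OF this] show False by linarith
  qed
  ultimately have "is_period D f i s a' b'"
    using a'(1) b'(1) run assms(2) unfolding is_period_def by linarith
  moreover have "b + 1 - a \<le> b' + 1 - a'" using a'(1) b'(1) by linarith
  ultimately show ?thesis by blast
qed

lemma sum_card_swap:
  "(\<Sum>d\<in>A. card {i. i < (n::nat) \<and> f i d}) = (\<Sum>i<n. card {d\<in>A. f i d})" if "finite A"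
proof -
  have "(\<Sum>d\<in>A. card {i. i < n \<and> f i d}) = (\<Sum>d\<in>A. \<Sum>i<n. of_bool (f i d))"
    by (intro sum.cong refl) (simp add: Int_def)
  also have "\<dots> = (\<Sum>i<n. \<Sum>d\<in>A. of_bool (f i d))" by (rule sum.swap)
  also have "\<dots> = (\<Sum>i<n. card {d\<in>A. f i d})"
    using that by (intro sum.cong refl) (simp add: Int_def)
  finally show ?thesis .
qed

lemma card_filter_compl: "finite A \<Longrightarrow> card {x\<in>A. P x} + card {x\<in>A. \<not> P x} = card A"
  by (subst card_Un_disjoint[symmetric]) (auto intro: arg_cong[where f = card])

text \<open>The witness counts all shifts up to a day. Apart from the daily requirements, each
  constraint is a bound for a single worker, summed over the workers: a window of u_w + 1 days
  contains an OFF day, and one of u_o + 1 days an ON day.\<close>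

lemma feasible_imp_sat:
  assumes feas: "feasible I f"
  shows "\<exists>X. sat (edges I) X"
proof
  let ?D = "days I" and ?N = "workers I"
  define on where "on A i = card {d\<in>A. f i d}" for A i
  define X where "X d = int (\<Sum>i<?N. on {1..d} i)" for d
  have diff: "X b = X a + int (\<Sum>i<?N. on {a<..b} i)" if "a \<le> b" for a b
  proof -
    have "on {1..b} i = on {1..a} i + on {a<..b} i" for i
    proof -
      have "{d\<in>{1..b}. f i d} = {d\<in>{1..a}. f i d} \<union> {d\<in>{a<..b}. f i d}" using that by auto
      thus ?thesis unfolding on_def by (subst card_Un_disjoint[symmetric]) auto
    qed
    thus ?thesis by (simp add: X_def sum.distrib)
  qed
  have upper: "X b \<le> X a + int (?N * k)" if "a \<le> b" "\<And>i. i < ?N \<Longrightarrow> on {a<..b} i \<le> k" for a b k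
    using diff[OF that(1)] sum_bounded_above[of "{..<?N}" "on {a<..b}" k] that(2)
    by (simp del: of_nat_sum of_nat_mult)
  have lower: "X a + int (?N * k) \<le> X b" if "a \<le> b" "\<And>i. i < ?N \<Longrightarrow> k \<le> on {a<..b} i" for a b k
    using diff[OF that(1)] sum_bounded_below[of "{..<?N}" k "on {a<..b}"] that(2)
    by (simp del: of_nat_sum of_nat_mult)
  have len: "\<not> (\<forall>d\<in>{a<..b}. f i d = s)"
    if asm: "i < ?N" "b \<le> ?D" "a < b" "b - a > (if s then uw I else uo I)" for a b i s
  proof
    assume "\<forall>d\<in>{a<..b}. f i d = s"
    then obtain a' b' where "is_period ?D f i s a' b'" "b + 1 - Suc a \<le> b' + 1 - a'"
      using run_in_period[of "Suc a" b ?D f i s] asm by (auto simp: Ball_def)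
    moreover from this have "b' + 1 - a' \<le> (if s then uw I else uo I)"
      using feas asm(1) by (cases s) (auto simp: feasible_def)
    ultimately show False using asm(4) by linarith
  qed
  have on_le: "on {a<..b} i \<le> b - a" for a b i
  proof -
    have "card {d\<in>{a<..b}. f i d} \<le> card {a<..b}" by (intro card_mono) auto
    thus ?thesis by (simp add: on_def)
  qed
  have on_all: "\<forall>d\<in>{a<..b}. f i d" if "on {a<..b} i \<ge> b - a" for a b i
  proof -
    have "{d\<in>{a<..b}. f i d} = {a<..b}" using that by (intro card_seteq) (auto simp: on_def)
    thus ?thesis by blast
  qed
  have on_none: "\<forall>d\<in>{a<..b}. f i d = False" if "on {a<..b} i = 0" for a b i
    using that by (auto simp: on_def)
  have day: "int (card {i. i < ?N \<and> f i d}) = X d - X (d - 1)" if "1 \<le> d" for d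
  proof -
    have "{d - 1<..d} = {d}" using that by auto
    thus ?thesis using diff[of "d - 1" d] sum_card_swap[of "{d}" ?N f] by (simp add: on_def)
  qed
  have "X d \<le> X (d - 1) + int (ru I d) \<and> X (d - 1) + int (rl I d) \<le> X d" if "d \<in> {1..?D}" for d
  proof -
    have "rl I d \<le> card {i. i < ?N \<and> f i d}" "card {i. i < ?N \<and> f i d} \<le> ru I d"
      using feas that by (auto simp: feasible_def)
    moreover have "1 \<le> d" using that by simp
    ultimately show ?thesis using day[of d] by linarith
  qed
  moreover have "X d \<le> X (d - uw I - 1) + int (?N * uw I)" if "d \<in> {1..?D}" "uw I < d" for d
  proof (rule upper)
    fix i assume "i < ?N"
    hence "\<not> (\<forall>e\<in>{d - uw I - 1<..d}. f i e = True)" using that by (intro len) auto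
    hence "\<not> d - (d - uw I - 1) \<le> on {d - uw I - 1<..d} i"
      using on_all[of d "d - uw I - 1" i] by blast
    thus "on {d - uw I - 1<..d} i \<le> uw I" using that by linarith
  qed simp
  moreover have "X (d - uo I - 1) + int (?N * 1) \<le> X d" if "d \<in> {1..?D}" "uo I < d" for d
  proof (rule lower)
    fix i assume "i < ?N"
    hence "\<not> (\<forall>e\<in>{d - uo I - 1<..d}. f i e = False)" using that by (intro len) auto
    hence "on {d - uo I - 1<..d} i \<noteq> 0" using on_none[of "d - uo I - 1" d i] by blast
    thus "1 \<le> on {d - uo I - 1<..d} i" by linarith
  qed simp
  moreover have all: "{0<..?D} = {1..?D}" by auto
  have "X ?D \<le> X 0 + int (?N * min (Uw I) ?D)"
    using feas on_le[of 0 ?D] by (intro upper) (auto simp: feasible_def on_def all)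
  moreover have "X 0 + int (?N * (?D - Uo I)) \<le> X ?D"
  proof (rule lower)
    fix i assume i: "i < ?N"
    have "on {1..?D} i + card {d\<in>{1..?D}. \<not> f i d} = ?D"
      using card_filter_compl[of "{1..?D}" "f i"] by (simp add: on_def)
    thus "?D - Uo I \<le> on {0<..?D} i" using feas i by (auto simp: feasible_def all)
  qed simp
  ultimately show "sat (edges I) X" unfolding sat_edges by simp
qed

section \<open>Sufficiency: cyclic distribution of the shifts\<close>

lemma sum_div_shift:
  fixes x :: int
  assumes "0 < N"
  shows "(\<Sum>i<N. (x + int k + int i) div int N) = (\<Sum>i<N. (x + int i) div int N) + int k"
proof (induction k)
  case (Suc k)
  let ?h = "\<lambda>i. (x + int k + int i) div int N"
  \<comment> \<open>As in Hermite's identity, raising \<open>x\<close> by 1 shifts the index, so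
    only the end terms change, and they differ by 1. Thus the \<open>N\<close> quotients together
    grow exactly as much as \<open>x\<close>.\<close>
  have "(\<Sum>i<N. (x + int (Suc k) + int i) div int N) = (\<Sum>i<N. ?h (Suc i))"
    by (simp add: add_ac)
  also have "\<dots> = (\<Sum>i<Suc N. ?h i) - ?h 0" by (simp only: sum.lessThan_Suc_shift)
  also have "\<dots> = (\<Sum>i<N. ?h i) + 1" using assms by (simp add: div_add_self2)
  finally show ?case using Suc by simp
qed simp

text \<open>The schedule assigns the workers to the shifts in cyclic order: worker \<open>i\<close> has had
  \<open>(X d + i) div N\<close> shifts, up to an additive constant, by the end of day \<open>d\<close>. So the
  numbers of shifts of any two workers differ by at most one on each interval of days.\<close>

lemma sat_imp_feasible:
  assumes inst: "udodosp_inst I" and X: "sat (edges I) X"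
  shows "\<exists>f. feasible I f"
proof
  let ?D = "days I" and ?N = "workers I"
  have N: "0 < ?N" and D: "1 \<le> ?D" and lw: "lw I = 1" "lo I = 1"
    and ruN: "\<And>d. d \<in> {1..?D} \<Longrightarrow> ru I d \<le> ?N"
    using inst by (auto simp: udodosp_inst_def valid_inst_def)
  note X = X[unfolded sat_edges]
  define g where "g i d = (X d + int i) div int ?N" for i d
  define f where "f i d \<longleftrightarrow> g i (d - 1) < g i d" for i d
  \<comment> \<open>Adding \<open>?N * k\<close> to the dividend adds exactly \<open>k\<close> to
    the quotient, so a bound on the total carries over to each worker \<open>i\<close>.\<close>
  have g_le: "g i b \<le> g i a + int k" if "X b \<le> X a + int (?N * k)" for i a b k
  proof -
    have "g i b \<le> (X a + int i + int k * int ?N) div int ?N"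
      unfolding g_def using that N by (intro zdiv_mono1) (auto simp: algebra_simps)
    thus ?thesis using N by (simp add: g_def)
  qed
  have g_ge: "g i a + int k \<le> g i b" if "X a + int (?N * k) \<le> X b" for i a b k
  proof -
    have "(X a + int i + int k * int ?N) div int ?N \<le> g i b"
      unfolding g_def using that N by (intro zdiv_mono1) (auto simp: algebra_simps)
    thus ?thesis using N by (simp add: g_def)
  qed
  \<comment> \<open>Here \<open>ru I d \<le> ?N\<close> excludes two shifts of one worker on one
    day, so the Boolean \<open>f\<close> loses no shift.\<close>
  have step: "g i d = g i (d - 1) + of_bool (f i d)" if "d \<in> {1..?D}" for i d
  proof -
    have "X d \<le> X (d - 1) + int (?N * 1)" using X that ruN[OF that] by fastforce
    moreover have "X (d - 1) + int (?N * 0) \<le> X d" using X that by fastforce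
    ultimately have "g i d \<le> g i (d - 1) + 1" "g i (d - 1) \<le> g i d"
      using g_le[of d "d - 1" 1 i] g_ge[of "d - 1" 0 d i] by auto
    thus ?thesis by (auto simp: f_def)
  qed
  have count: "int (card {d\<in>{a<..a + k}. f i d}) = g i (a + k) - g i a" if "a + k \<le> ?D" for a k i
    using that
  proof (induction k)
    case (Suc k)
    have "{d\<in>{a<..a + Suc k}. f i d} =
        (if f i (a + Suc k) then insert (a + Suc k) {d\<in>{a<..a + k}. f i d} else {d\<in>{a<..a + k}. f i d})"
      by (auto simp: le_Suc_eq)
    hence "int (card {d\<in>{a<..a + Suc k}. f i d}) = int (card {d\<in>{a<..a + k}. f i d}) + of_bool (f i (a + Suc k))"
      by simp
    thus ?case using Suc step[of "a + Suc k" i] by simp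
  qed simp
  have "rl I d \<le> card {i. i < ?N \<and> f i d} \<and> card {i. i < ?N \<and> f i d} \<le> ru I d" if d: "d \<in> {1..?D}" for d
  proof -
    have le: "X (d - 1) + int (rl I d) \<le> X d" "X d \<le> X (d - 1) + int (ru I d)" using X d by auto
    define k where "k = nat (X d - X (d - 1))"
    have k: "X d = X (d - 1) + int k" using le by (simp add: k_def)
    have "int (card {i. i < ?N \<and> f i d}) = (\<Sum>i<?N. of_bool (f i d))"
      by (simp add: Int_def)
    also have "\<dots> = (\<Sum>i<?N. g i d - g i (d - 1))"
      using step[OF d] by (intro sum.cong) auto
    also have "\<dots> = int k"
      using sum_div_shift[OF N, of "X (d - 1)" k] by (simp add: sum_subtractf g_def k)
    finally show ?thesis using le k by linarith
  qed
  moreover have "b + 1 - a \<le> uw I" if p: "is_period ?D f i True a b" for i a b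
  proof (rule ccontr)
    assume *: "\<not> ?thesis"
    have ab: "1 \<le> a" "b \<le> ?D" "\<And>d. d \<in> {a..b} \<Longrightarrow> f i d" using p by (auto simp: is_period_def)
    \<comment> \<open>The first \<open>uw I + 1\<close> days of a period that is too long end on day
      \<open>e\<close> and form a constrained window.\<close>
    define e where "e = a - 1 + Suc (uw I)"
    have e: "e \<in> {1..?D}" "uw I < e" "e - uw I - 1 = a - 1" "e \<le> b" using * ab by (auto simp: e_def)
    have "{d\<in>{a - 1<..e}. f i d} = {a - 1<..e}" using ab e by auto
    hence "g i e - g i (a - 1) = int (Suc (uw I))"
      using count[of "a - 1" "Suc (uw I)" i] e by (simp add: e_def)
    moreover have "X e \<le> X (a - 1) + int (?N * uw I)" using X e by metis
    ultimately show False using g_le[of e "a - 1" "uw I" i] by linarith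
  qed
  moreover have "b + 1 - a \<le> uo I" if p: "is_period ?D f i False a b" for i a b
  proof (rule ccontr)
    assume *: "\<not> ?thesis"
    have ab: "1 \<le> a" "b \<le> ?D" "\<And>d. d \<in> {a..b} \<Longrightarrow> \<not> f i d" using p by (auto simp: is_period_def)
    define e where "e = a - 1 + Suc (uo I)"
    have e: "e \<in> {1..?D}" "uo I < e" "e - uo I - 1 = a - 1" "e \<le> b" using * ab by (auto simp: e_def)
    have "{d\<in>{a - 1<..e}. f i d} = {}" using ab e by auto
    hence "card {d\<in>{a - 1<..e}. f i d} = 0" by (simp only: card.empty)
    moreover have "int (card {d\<in>{a - 1<..e}. f i d}) = g i e - g i (a - 1)"
      using count[of "a - 1" "Suc (uo I)" i] e(1) unfolding e_def by simp
    ultimately have "g i e = g i (a - 1)" by linarith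
    moreover have "X (a - 1) + int (?N * 1) \<le> X e" using X e by (metis mult.right_neutral)
    ultimately show False using g_ge[of "a - 1" 1 e i] by linarith
  qed
  moreover have "card {d\<in>{1..?D}. f i d} \<le> Uw I \<and> card {d\<in>{1..?D}. \<not> f i d} \<le> Uo I" for i
  proof -
    have "{0<..?D} = {1..?D}" by auto
    hence c: "int (card {d\<in>{1..?D}. f i d}) = g i ?D - g i 0" using count[of 0 ?D i] by simp
    have "?N * min (Uw I) ?D \<le> ?N * Uw I" by simp
    hence "X ?D \<le> X 0 + int (?N * Uw I)" using X by linarith
    hence "g i ?D \<le> g i 0 + int (Uw I)" by (rule g_le)
    moreover have "g i 0 + int (?D - Uo I) \<le> g i ?D" using X by (intro g_ge) auto
    moreover have "card {d\<in>{1..?D}. f i d} + card {d\<in>{1..?D}. \<not> f i d} = card {1..?D}"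
      by (intro card_filter_compl) simp
    ultimately show ?thesis using c by auto
  qed
  \<comment> \<open>Here l_w = l_o = 1 enters: periods are nonempty.\<close>
  moreover have "1 \<le> b + 1 - a" if "is_period ?D f i s a b" for i s a b
    using that by (auto simp: is_period_def)
  ultimately show "feasible I f" unfolding feasible_def lw by blast
qed

theorem has_feasible_schedule_iff_sat:
  "udodosp_inst I \<Longrightarrow> has_feasible_schedule I \<longleftrightarrow> (\<exists>X. sat (edges I) X)"
  unfolding has_feasible_schedule_def using feasible_imp_sat sat_imp_feasible by blast

section \<open>A structured language compiled to the RAM\<close>

type_synonym mem = "nat \<Rightarrow> int"

datatype com =
    Block "instr list"
  | Seq com com  (infixr ";;" 60)
  | IfPos nat com
  | WhilePos nat com

fun clen :: "com \<Rightarrow> nat" where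
  "clen (Block is) = length is"
| "clen (c1 ;; c2) = clen c1 + clen c2"
| "clen (IfPos r c) = Suc (clen c)"
| "clen (WhilePos r c) = clen c + 2"

text \<open>Jump targets are absolute, hence the start address \<open>n\<close>.\<close>

fun compile :: "com \<Rightarrow> nat \<Rightarrow> instr list" where
  "compile (Block is) n = is"
| "compile (c1 ;; c2) n = compile c1 n @ compile c2 (n + clen c1)"
| "compile (IfPos r c) n = Jlez r (n + 1 + clen c) # compile c (n + 1)"
| "compile (WhilePos r c) n = Jlez r (n + 2 + clen c) # compile c (n + 1) @ [Jmp n]"

lemma length_compile [simp]: "length (compile c n) = clen c"
  by (induction c arbitrary: n) auto

text \<open>Total correctness with a time bound. Quantifying over the surrounding code
  \<open>A\<close> and \<open>B\<close> makes it independent of position, so that pieces compose;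
  control must leave exactly at the end of the piece.\<close>

definition runs :: "com \<Rightarrow> mem \<Rightarrow> nat \<Rightarrow> (mem \<Rightarrow> bool) \<Rightarrow> bool" where
  "runs c m t Q \<longleftrightarrow> (\<forall>A B. \<exists>t'\<le>t. \<exists>m'.
     exec (A @ compile c (length A) @ B) t' (length A, m) = (length A + clen c, m') \<and> Q m')"

lemma exec_0 [simp]: "exec P 0 c = c"
  by (simp add: exec_def)

lemma exec_Suc: "exec P (Suc t) c = exec P t (step P c)"
  by (simp add: exec_def funpow_Suc_right del: funpow.simps)

lemma exec_add: "exec P (t + t') c = exec P t' (exec P t c)"
  by (simp add: exec_def funpow_add add.commute[of t])

lemma step_nth:
  "P = A @ i # B \<Longrightarrow> i \<noteq> Halt \<Longrightarrow> step P (length A, m) = exec_instr i (length A, m)"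
  by (simp add: step_def halted_def)

lemma runs_mono: "runs c m t Q \<Longrightarrow> t \<le> t' \<Longrightarrow> (\<And>m. Q m \<Longrightarrow> Q' m) \<Longrightarrow> runs c m t' Q'"
  unfolding runs_def by (meson order.trans)

lemma runs_Seq:
  assumes "runs c1 m t1 Q" "\<And>m. Q m \<Longrightarrow> runs c2 m t2 R"
  shows "runs (c1 ;; c2) m (t1 + t2) R"
  unfolding runs_def
proof (intro allI)
  fix A B
  let ?P = "A @ compile (c1 ;; c2) (length A) @ B"
  obtain t1' m1 where 1: "t1' \<le> t1" "exec ?P t1' (length A, m) = (length A + clen c1, m1)" "Q m1"
    using assms(1)[unfolded runs_def, rule_format, of A "compile c2 (length A + clen c1) @ B"] by auto
  obtain t2' m2 where 2: "t2' \<le> t2"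
    "exec ?P t2' (length A + clen c1, m1) = (length A + clen c1 + clen c2, m2)" "R m2"
    using assms(2)[OF 1(3), unfolded runs_def, rule_format, of "A @ compile c1 (length A)" B] by auto
  show "\<exists>t'\<le>t1 + t2. \<exists>m'. exec ?P t' (length A, m) = (length A + clen (c1 ;; c2), m') \<and> R m'"
    using 1 2 by (intro exI[of _ "t1' + t2'"]) (auto simp: exec_add)
qed

lemma runs_IfPos:
  assumes "0 < m r \<Longrightarrow> runs c m t Q" "m r \<le> 0 \<Longrightarrow> Q m"
  shows "runs (IfPos r c) m (Suc t) Q"
  unfolding runs_def
proof (intro allI)
  fix A B
  let ?P = "A @ compile (IfPos r c) (length A) @ B"
  let ?pc = "if m r \<le> 0 then length A + 1 + clen c else length A + 1"
  have s: "step ?P (length A, m) = (?pc, m)" by (subst step_nth) auto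
  show "\<exists>t'\<le>Suc t. \<exists>m'. exec ?P t' (length A, m) = (length A + clen (IfPos r c), m') \<and> Q m'"
  proof (cases "0 < m r")
    case True
    obtain t' m' where "t' \<le> t" "exec ?P t' (length A + 1, m) = (length A + 1 + clen c, m')" "Q m'"
      using assms(1)[OF True, unfolded runs_def, rule_format,
          of "A @ [Jlez r (length A + 1 + clen c)]" B] by auto
    thus ?thesis using True s by (intro exI[of _ "Suc t'"]) (auto simp: exec_Suc)
  next
    case False
    thus ?thesis using assms(2) s by (intro exI[of _ "Suc 0"]) (auto simp: exec_Suc)
  qed
qed

text \<open>\<open>Inv\<close> is indexed by the number of iterations still to come, which gives
  termination. \<open>t + 2\<close> pays for the body, the test and the jump back,
  \<open>+ 1\<close> for the final test.\<close>

lemma runs_WhilePos: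
  assumes "\<And>k m. Inv (Suc k) m \<Longrightarrow> 0 < m r \<and> runs c m t (Inv k)"
    and "\<And>m. Inv 0 m \<Longrightarrow> m r \<le> 0" and "Inv k m"
  shows "runs (WhilePos r c) m (k * (t + 2) + 1) (Inv 0)"
  unfolding runs_def
proof (intro allI)
  fix A B
  let ?P = "A @ compile (WhilePos r c) (length A) @ B"
  have s: "step ?P (length A, m) =
      (if m r \<le> 0 then length A + 2 + clen c else length A + 1, m)" for m
    by (subst step_nth) auto
  have jmp: "step ?P (length A + 1 + clen c, m) = (length A, m)" for m
    using step_nth[of ?P "A @ Jlez r (length A + 2 + clen c) # compile c (length A + 1)" "Jmp (length A)" B m]
    by simp
  show "\<exists>t'\<le>k * (t + 2) + 1. \<exists>m'.
      exec ?P t' (length A, m) = (length A + clen (WhilePos r c), m') \<and> Inv 0 m'"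
    using assms(3)
  proof (induction k arbitrary: m)
    case 0
    thus ?case using assms(2) s by (intro exI[of _ "Suc 0"]) (auto simp: exec_Suc)
  next
    case (Suc k)
    note body = assms(1)[OF Suc.prems]
    obtain t1 m1 where 1: "t1 \<le> t" "exec ?P t1 (length A + 1, m) = (length A + 1 + clen c, m1)" "Inv k m1"
      using conjunct2[OF body, unfolded runs_def, rule_format,
          of "A @ [Jlez r (length A + 2 + clen c)]" "[Jmp (length A)] @ B"] by auto
    obtain t2 m2 where 2: "t2 \<le> k * (t + 2) + 1"
      "exec ?P t2 (length A, m1) = (length A + clen (WhilePos r c), m2)" "Inv 0 m2"
      using Suc.IH[OF 1(3)] by auto
    have "exec ?P (Suc (t1 + Suc t2)) (length A, m) = (length A + clen (WhilePos r c), m2)"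
      using body by (simp only: exec_Suc exec_add s 1(2) jmp 2(2) not_le[symmetric] if_False simp_thms)
    thus ?case using 1(1) 2(1,3) by (intro exI[of _ "Suc (t1 + Suc t2)"]) auto
  qed
qed

fun prim :: "instr \<Rightarrow> bool" where
  "prim (Jmp t) = False"
| "prim (Jlez r t) = False"
| "prim Halt = False"
| "prim _ = True"

definition eff :: "instr \<Rightarrow> mem \<Rightarrow> mem" where
  "eff i m = snd (exec_instr i (0, m))"

lemma eff_simps [simp]:
  "eff (LoadC r k) m = m(r := k)"
  "eff (Add r a b) m = m(r := m a + m b)"
  "eff (Sub r a b) m = m(r := m a - m b)"
  "eff (LoadI r a) m = m(r := m (nat (m a)))"
  "eff (StoreI a b) m = m(nat (m a) := m b)"
  by (simp_all add: eff_def)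

lemma runs_Block:
  assumes "list_all prim is"
  shows "runs (Block is) m (length is) (\<lambda>m'. m' = fold eff is m)"
  unfolding runs_def
proof (intro allI)
  fix A B
  have "exec (A @ is @ B) (length is) (length A, m) = (length A + length is, fold eff is m)"
    using assms
  proof (induction "is" arbitrary: A m)
    case (Cons i "is")
    have "step (A @ (i # is) @ B) (length A, m) = exec_instr i (length A, m)"
      using Cons.prems by (intro step_nth) auto
    also have "\<dots> = (length (A @ [i]), eff i m)" using Cons.prems by (cases i) auto
    finally show ?case using Cons.IH[of "A @ [i]" "eff i m"] Cons.prems by (simp add: exec_Suc)
  qed simp
  thus "\<exists>t'\<le>length is. \<exists>m'. exec (A @ compile (Block is) (length A) @ B) t' (length A, m)
      = (length A + clen (Block is), m') \<and> m' = fold eff is m" by auto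
qed

fun loopfree :: "com \<Rightarrow> bool" where
  "loopfree (Block is) = list_all prim is"
| "loopfree (c1 ;; c2) \<longleftrightarrow> loopfree c1 \<and> loopfree c2"
| "loopfree (IfPos r c) = loopfree c"
| "loopfree (WhilePos r c) = False"

text \<open>Meaningful for loop-free commands only.\<close>
fun sem :: "com \<Rightarrow> mem \<Rightarrow> mem" where
  "sem (Block is) m = fold eff is m"
| "sem (c1 ;; c2) m = sem c2 (sem c1 m)"
| "sem (IfPos r c) m = (if 0 < m r then sem c m else m)"
| "sem (WhilePos r c) m = m"

text \<open>Without loops each instruction runs at most once, so the code length bounds the time and
  correctness reduces to evaluating \<open>sem\<close>.\<close>

lemma runs_loopfree: "loopfree c \<Longrightarrow> runs c m (clen c) (\<lambda>m'. m' = sem c m)"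
proof (induction c arbitrary: m)
  case (Block "is")
  thus ?case using runs_Block by simp
next
  case (Seq c1 c2)
  thus ?case by (auto intro!: runs_Seq)
next
  case (IfPos r c)
  have "runs (IfPos r c) m (Suc (clen c)) (\<lambda>m'. m' = sem (IfPos r c) m)"
    using IfPos by (intro runs_IfPos) auto
  thus ?case by simp
qed simp

lemma runs_loopfreeI: "loopfree c \<Longrightarrow> clen c \<le> t \<Longrightarrow> Q (sem c m) \<Longrightarrow> runs c m t Q"
  using runs_mono[OF runs_loopfree] by metis

section \<open>The program\<close>

text \<open>Registers \<open>u\<close> and \<open>v\<close> hold addresses of potentials, register
  \<open>w\<close> holds the weight. Register 22 becomes \<open>X v - (X u + w)\<close>, which is
  positive iff the edge is violated.\<close>

definition relax_com :: "nat \<Rightarrow> nat \<Rightarrow> nat \<Rightarrow> com" where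
  "relax_com u v w =
     Block [LoadI 20 u, Add 20 20 w, LoadI 21 v, Sub 22 21 20] ;;
     IfPos 22 (Block [StoreI v 20, LoadC 14 1])"

text \<open>Register 20 holds the address of an input cell; addresses below 24, the content of
  register 23, are redirected to the moved copy.\<close>

definition fetch_com :: com where
  "fetch_com = Block [Sub 21 23 20] ;; IfPos 21 (Block [Add 20 20 2]) ;; Block [LoadI 19 20]"

text \<open>Registers 0 to 23 are working memory. The input cells 8 to 23, which they overwrite, are
  moved to \<open>2 D + 24 + 8, \<dots>, 2 D + 24 + 23\<close>, beyond the input; the potentials of
  the days 0 to \<open>D\<close> are in the cells \<open>2 D + 48, \<dots>, 3 D + 48\<close>, which are
  initially 0. Register 2 holds \<open>2 D + 24\<close>, register 9 the address of the potential of day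
  0, registers 10 to 13 edge weights, 14 the flag, 15 the number of remaining rounds, 16 the
  current day (or a loop counter of the set-up), 17 and 18 addresses of potentials.\<close>

definition day_com :: com where
  "day_com =
     Block [Add 17 9 16, Sub 18 17 8, Add 20 16 16, LoadC 21 7, Add 20 20 21] ;; fetch_com ;;
     relax_com 18 17 19 ;;
     Block [Add 20 16 16, LoadC 21 6, Add 20 20 21] ;; fetch_com ;;
     Block [LoadC 20 0, Sub 19 20 19] ;;
     relax_com 17 18 19 ;;
     Block [Sub 4 16 3] ;;
     IfPos 4 (Block [Add 18 9 4, Sub 18 18 8] ;; relax_com 18 17 10) ;;
     Block [Sub 4 16 5] ;;
     IfPos 4 (Block [Add 18 9 4, Sub 18 18 8] ;; relax_com 17 18 13) ;;
     Block [Sub 16 16 8]"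

definition round_com :: com where
  "round_com =
     Block [LoadC 14 0, LoadC 16 0, Add 16 16 0] ;;
     WhilePos 16 day_com ;;
     (Block [Add 17 9 0] ;; relax_com 9 17 11 ;; relax_com 17 9 12 ;; Block [Sub 15 15 8])"

definition mult_com :: "nat \<Rightarrow> nat \<Rightarrow> com" where
  "mult_com r s = Block [LoadC r 0] ;; WhilePos 16 (Block [Add r r s, Sub 16 16 8])"

text \<open>Register 0 holds D. Clipping the counter 16 to D keeps the multiplication that follows
  within D iterations.\<close>

definition min_com :: "nat \<Rightarrow> com" where
  "min_com r = Block [LoadC 16 0, Add 16 16 r, Sub 4 r 0] ;; IfPos 4 (Block [Sub 16 16 4])"

text \<open>Straight-line code, as the number of moved cells is constant. The upper end is a
  parameter for the induction in \<open>stash_eff\<close>.\<close>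

definition stash :: "nat \<Rightarrow> instr list" where
  "stash n = concat (map (\<lambda>j. [LoadC 4 (int j), Add 4 4 2, StoreI 4 j]) [8..<n])"

text \<open>Registers 2 and 4 may be reused since l_w = l_o = 1 is known. Register 15 starts at D +
  2, one more than the number of vertices. If U_o exceeds D, the counter 16 is negative and the
  product 0, as the truncated subtraction in \<open>edges\<close> demands.\<close>

definition setup_com :: com where
  "setup_com =
     (Block [Add 2 0 0, LoadC 4 24, Add 2 2 4] ;; Block (stash 24) ;;
      Block [LoadC 8 1, LoadC 23 24, Add 9 2 23, LoadC 13 0, Sub 13 13 1]) ;;
     min_com 3 ;; mult_com 10 1 ;;
     min_com 6 ;; mult_com 11 1 ;;
     Block [Sub 16 0 7] ;; mult_com 12 13 ;;
     Block [LoadC 14 0, LoadC 15 2, Add 15 15 0]"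

definition main_com :: com where
  "main_com = setup_com ;; WhilePos 15 round_com ;; Block [Sub 0 8 14]"

text \<open>Split off from \<open>rep\<close> because it holds as soon as the input is moved and the
  constants are loaded, before the weights are known, and so can be carried through the
  set-up.\<close>

definition base_rep :: "dodosp_inst \<Rightarrow> mem \<Rightarrow> bool" where
  "base_rep I m \<longleftrightarrow>
     m 0 = int (days I) \<and> m 1 = int (workers I) \<and> m 2 = int (2 * days I + 24) \<and>
     m 3 = int (uw I) \<and> m 5 = int (uo I) \<and> m 6 = int (Uw I) \<and> m 7 = int (Uo I) \<and>
     m 8 = 1 \<and> m 9 = int (2 * days I + 48) \<and> m 13 = - int (workers I) \<and> m 23 = 24 \<and>
     (\<forall>j\<in>{8..<24}. m (2 * days I + 24 + j) = encode I j) \<and>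
     (\<forall>j\<in>{24..<8 + 2 * days I}. m j = encode I j)"

definition rep :: "dodosp_inst \<Rightarrow> (nat \<Rightarrow> int) \<times> bool \<Rightarrow> mem \<Rightarrow> bool" where
  "rep I s m \<longleftrightarrow> base_rep I m \<and>
     m 10 = int (workers I * min (uw I) (days I)) \<and>
     m 11 = int (workers I * min (Uw I) (days I)) \<and>
     m 12 = - int (workers I * (days I - Uo I)) \<and>
     m 14 = of_bool (snd s) \<and> (\<forall>k\<le>days I. m (2 * days I + 48 + k) = fst s k)"

section \<open>Correctness of one round of the program\<close>

lemma base_rep_cong:
  assumes "base_rep I m" "\<And>a. a \<notin> {4, 10, 11, 12} \<union> {14..22} \<Longrightarrow> a < 2 * days I + 48 \<Longrightarrow> m' a = m a"
  shows "base_rep I m'"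
  using assms(1) unfolding base_rep_def by (simp add: assms(2))

lemma rep_cong:
  assumes "rep I s m" "\<And>a. a \<notin> insert 4 {15..22} \<Longrightarrow> m' a = m a"
  shows "rep I s m'"
proof -
  have "base_rep I m" using assms(1) by (simp add: rep_def)
  hence "base_rep I m'" by (rule base_rep_cong) (rule assms(2), simp)
  thus ?thesis using assms(1) unfolding rep_def by (simp add: assms(2))
qed

text \<open>The conditions \<open>regs\<close> exclude interference: register 20 is overwritten
  before \<open>w\<close> is read, registers 20 to 22 before \<open>v\<close> is read for the last
  time.\<close>

lemma rep_relax_com:
  assumes rep: "rep I s m" and u: "m u = int (2 * days I + 48 + i)"
    and v: "m v = int (2 * days I + 48 + j)" and ij: "i \<le> days I" "j \<le> days I"
    and x: "m w = x" and regs: "w \<noteq> 20" "v \<notin> {20, 21, 22}"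
  shows "rep I (relax (i, j, x) s) (sem (relax_com u v w) m)"
    and "r \<in> {15..19} \<Longrightarrow> sem (relax_com u v w) m r = m r"
proof -
  obtain X f where s: "s = (X, f)" by (cases s)
  have nat: "nat (m u) = 2 * days I + 48 + i" "nat (m v) = 2 * days I + 48 + j"
    unfolding u v by (rule nat_int)+
  have val: "m (2 * days I + 48 + i) = X i" "m (2 * days I + 48 + j) = X j"
    using rep ij by (auto simp: rep_def s)
  define m1 where "m1 = m(20 := X i + x, 21 := X j, 22 := X j - (X i + x))"
  have sem: "sem (relax_com u v w) m =
      (if X i + x < X j then m1(2 * days I + 48 + j := X i + x, 14 := 1) else m1)"
    using regs x by (simp add: relax_com_def m1_def nat val)
  have m1: "rep I s m1" by (rule rep_cong[OF rep]) (auto simp: m1_def)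
  show "rep I (relax (i, j, x) s) (sem (relax_com u v w) m)"
  proof (cases "X i + x < X j")
    case True
    have "base_rep I (m1(2 * days I + 48 + j := X i + x, 14 := 1))"
      by (rule base_rep_cong[of I m1]) (use m1 in \<open>auto simp: rep_def\<close>)
    thus ?thesis using True m1 unfolding sem by (simp add: rep_def s)
  qed (use m1 sem s in simp)
  show "sem (relax_com u v w) m r = m r" if "r \<in> {15..19}"
    using that unfolding sem m1_def by simp
qed

lemma rep_fetch_com:
  assumes rep: "rep I s m" and j: "m 20 = int j" "8 \<le> j" "j < 8 + 2 * days I"
  shows "rep I s (sem fetch_com m)"
    and "sem fetch_com m 19 = encode I j"
    and "r \<in> {15..18} \<Longrightarrow> sem fetch_com m r = m r"
proof -
  have b: "m 2 = int (2 * days I + 24)" "m 23 = 24" using rep by (auto simp: rep_def base_rep_def)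
  define k where "k = (if j < 24 then 2 * days I + 24 + j else j)"
  have k: "m k = encode I j" "24 \<le> k" using rep j by (auto simp: k_def rep_def base_rep_def)
  have "sem fetch_com m = m(21 := 24 - int j, 20 := int k, 19 := encode I j)"
  proof (cases "j < 24")
    case True
    have "nat (int j + int (2 * days I + 24)) = k"
      using True by (simp add: k_def nat_add_distrib)
    moreover have "int j + int (2 * days I + 24) = int k" using True by (simp add: k_def)
    ultimately show ?thesis using k True by (simp add: fetch_com_def j(1) b del: of_nat_add)
  next
    case False
    thus ?thesis using k by (simp add: fetch_com_def j(1) b k_def fun_upd_idem)
  qed
  moreover from this show "rep I s (sem fetch_com m)" by (intro rep_cong[OF rep]) auto
  ultimately show "sem fetch_com m 19 = encode I j"
    and "r \<in> {15..18} \<Longrightarrow> sem fetch_com m r = m r" by auto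
qed

lemma rep_day_com:
  assumes rep: "rep I s m" and d: "m 16 = int d" "1 \<le> d" "d \<le> days I"
  shows "rep I (fold relax (day_edges I d) s) (sem day_com m)"
    and "sem day_com m 16 = int (d - 1)" and "sem day_com m 15 = m 15"
proof -
  let ?B = "2 * days I + 48"
  have enc: "encode I (7 + 2 * d) = int (ru I d)" "encode I (6 + 2 * d) = int (rl I d)"
    using d by (auto simp: encode_def)
  have regs: "m 9 = int ?B" "m 8 = 1" "m 3 = int (uw I)" "m 5 = int (uo I)"
    if "rep I s m" for s m using that by (auto simp: rep_def base_rep_def)
  let ?ok = "\<lambda>m'. m' 16 = int d \<and> m' 17 = int (?B + d) \<and> m' 15 = m 15"
  \<comment> \<open>\<open>m1\<close> to \<open>m11\<close> are the memories between the pieces of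
    \<open>day_com\<close>; \<open>s3\<close>, \<open>s7\<close>, \<open>s9\<close>,
    \<open>s11\<close> are the states after the successive edges of
    \<open>day_edges\<close>.\<close>
  define m1 where "m1 = sem (Block [Add 17 9 16, Sub 18 17 8, Add 20 16 16, LoadC 21 7, Add 20 20 21]) m"
  have rep1: "rep I s m1" by (rule rep_cong[OF rep]) (auto simp: m1_def)
  have m1: "m1 20 = int (7 + 2 * d)" "?ok m1" "m1 18 = int (?B + (d - 1))"
    using d by (auto simp: m1_def regs[OF rep])
  define m2 where "m2 = sem fetch_com m1"
  have m2: "rep I s m2" "m2 19 = int (ru I d)" "?ok m2" "m2 18 = int (?B + (d - 1))"
    using rep_fetch_com[OF rep1 m1(1)] m1 d by (auto simp: m2_def enc)
  define s3 m3 where "s3 = relax (d - 1, d, int (ru I d)) s" and "m3 = sem (relax_com 18 17 19) m2"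
  have m3: "rep I s3 m3" "?ok m3" "m3 18 = int (?B + (d - 1))"
    using rep_relax_com[of I s m2 18 "d - 1" 17 d 19 "int (ru I d)"] m2 d by (auto simp: m3_def s3_def)
  define m4 where "m4 = sem (Block [Add 20 16 16, LoadC 21 6, Add 20 20 21]) m3"
  have rep4: "rep I s3 m4" by (rule rep_cong[OF m3(1)]) (auto simp: m4_def)
  have m4: "m4 20 = int (6 + 2 * d)" "?ok m4" "m4 18 = int (?B + (d - 1))"
    using m3 d by (auto simp: m4_def)
  define m5 where "m5 = sem fetch_com m4"
  have m5: "rep I s3 m5" "m5 19 = int (rl I d)" "?ok m5" "m5 18 = int (?B + (d - 1))"
    using rep_fetch_com[OF rep4 m4(1)] m4 d by (auto simp: m5_def enc)
  define m6 where "m6 = sem (Block [LoadC 20 0, Sub 19 20 19]) m5"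
  have rep6: "rep I s3 m6" by (rule rep_cong[OF m5(1)]) (auto simp: m6_def)
  have m6: "m6 19 = - int (rl I d)" "?ok m6" "m6 18 = int (?B + (d - 1))"
    using m5 by (auto simp: m6_def)
  define s7 m7 where "s7 = relax (d, d - 1, - int (rl I d)) s3" and "m7 = sem (relax_com 17 18 19) m6"
  have m7: "rep I s7 m7" "?ok m7"
    using rep_relax_com[of I s3 m6 17 d 18 "d - 1" 19 "- int (rl I d)"] rep6 m6 d
    by (auto simp: m7_def s7_def)
  define m8 where "m8 = sem (Block [Sub 4 16 3]) m7"
  have m8: "rep I s7 m8" by (rule rep_cong[OF m7(1)]) (auto simp: m8_def)
  have m8': "m8 4 = int d - int (uw I)" "?ok m8"
    using m7 regs[OF m7(1)] by (auto simp: m8_def)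
  define s9 m9 where
    "s9 = (if uw I < d then relax (d - uw I - 1, d, int (workers I * min (uw I) (days I))) s7 else s7)" and
    "m9 = sem (IfPos 4 (Block [Add 18 9 4, Sub 18 18 8] ;; relax_com 18 17 10)) m8"
  have m9: "rep I s9 m9 \<and> ?ok m9"
  proof (cases "uw I < d")
    case True
    define n where "n = sem (Block [Add 18 9 4, Sub 18 18 8]) m8"
    have n: "rep I s7 n" by (rule rep_cong[OF m8]) (auto simp: n_def)
    have n': "n 18 = int (?B + (d - uw I - 1))" "?ok n" using m8' True regs[OF m8] by (auto simp: n_def)
    have n10: "n 10 = int (workers I * min (uw I) (days I))" using n by (simp add: rep_def)
    have "m9 = sem (relax_com 18 17 10) n" using True m8' by (simp add: m9_def n_def)
    thus ?thesis
      using rep_relax_com[OF n, of 18 "d - uw I - 1" 17 d 10] n' n10 True d by (auto simp: s9_def)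
  qed (use m8 m8' in \<open>simp add: m9_def s9_def\<close>)
  define m10 where "m10 = sem (Block [Sub 4 16 5]) m9"
  have m10: "rep I s9 m10" by (rule rep_cong[OF conjunct1[OF m9]]) (auto simp: m10_def)
  have m10': "m10 4 = int d - int (uo I)" "?ok m10"
    using m9 regs[OF conjunct1[OF m9]] by (auto simp: m10_def)
  define s11 m11 where
    "s11 = (if uo I < d then relax (d, d - uo I - 1, - int (workers I)) s9 else s9)" and
    "m11 = sem (IfPos 4 (Block [Add 18 9 4, Sub 18 18 8] ;; relax_com 17 18 13)) m10"
  have m11: "rep I s11 m11 \<and> ?ok m11"
  proof (cases "uo I < d")
    case True
    define n where "n = sem (Block [Add 18 9 4, Sub 18 18 8]) m10"
    have n: "rep I s9 n" by (rule rep_cong[OF m10]) (auto simp: n_def)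
    have n': "n 18 = int (?B + (d - uo I - 1))" "?ok n" using m10' True regs[OF m10] by (auto simp: n_def)
    have n13: "n 13 = - int (workers I)" using n by (simp add: rep_def base_rep_def)
    have "m11 = sem (relax_com 17 18 13) n" using True m10' by (simp add: m11_def n_def)
    thus ?thesis
      using rep_relax_com[OF n, of 17 d 18 "d - uo I - 1" 13] n' n13 True d by (auto simp: s11_def)
  qed (use m10 m10' in \<open>simp add: m11_def s11_def\<close>)
  have sem: "sem day_com m = m11(16 := m11 16 - m11 8)"
    unfolding day_com_def m11_def m10_def m9_def m8_def m7_def m6_def m5_def m4_def m3_def m2_def m1_def
    by (simp only: sem.simps(2)) simp
  have "s11 = fold relax (day_edges I d) s"
    by (simp add: day_edges_def s11_def s9_def s7_def s3_def)
  moreover have "rep I s11 (sem day_com m)"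
    by (rule rep_cong[OF conjunct1[OF m11]]) (auto simp: sem)
  ultimately show "rep I (fold relax (day_edges I d) s) (sem day_com m)" by simp
  show "sem day_com m 16 = int (d - 1)" "sem day_com m 15 = m 15"
    using m11 regs[OF conjunct1[OF m11]] d by (auto simp: sem)
qed

lemma runs_day_loop:
  assumes "rep I s m" "m 16 = int (days I)" "m 15 = c"
  shows "runs (WhilePos 16 day_com) m (days I * 102 + 1) (\<lambda>m'.
    rep I (fold relax (concat (map (day_edges I) (rev [1..<Suc (days I)]))) s) m' \<and> m' 15 = c)"
proof -
  define Inv where "Inv k m \<longleftrightarrow> k \<le> days I \<and> m 16 = int k \<and> m 15 = c \<and>
    rep I (fold relax (concat (map (day_edges I) (rev [Suc k..<Suc (days I)]))) s) m" for k m
  \<comment> \<open>100 is a generous bound on the length of \<open>day_com\<close>.\<close>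
  have "runs (WhilePos 16 day_com) m (days I * (100 + 2) + 1) (Inv 0)"
  proof (rule runs_WhilePos)
    show "Inv (days I) m" using assms by (simp add: Inv_def)
  next
    fix k m assume "Inv (Suc k) m"
    hence m: "Suc k \<le> days I" "m 16 = int (Suc k)" "m 15 = c"
      "rep I (fold relax (concat (map (day_edges I) (rev [Suc (Suc k)..<Suc (days I)]))) s) m"
      by (auto simp: Inv_def simp del: upt_Suc)
    have "rev [Suc k..<Suc (days I)] = rev [Suc (Suc k)..<Suc (days I)] @ [Suc k]"
      using m(1) by (simp add: upt_conv_Cons del: upt_Suc)
    hence "Inv k (sem day_com m)"
      using rep_day_com[OF m(4,2) _ m(1)] m by (simp add: Inv_def del: upt_Suc)
    moreover have "loopfree day_com" "clen day_com \<le> 100"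
      by (simp_all add: day_com_def fetch_com_def relax_com_def)
    ultimately have "runs day_com m 100 (Inv k)" by (intro runs_loopfreeI)
    thus "0 < m 16 \<and> runs day_com m 100 (Inv k)" using m(2) by simp
  qed (simp add: Inv_def)
  thus ?thesis by (rule runs_mono) (auto simp: Inv_def)
qed

lemma runs_round_com:
  assumes "rep I s m" "m 15 = int (Suc k)"
  shows "runs round_com m (3 + (days I * 102 + 1 + 20))
    (\<lambda>m'. rep I (bf_round (edges I) s) m' \<and> m' 15 = int k)"
  unfolding round_com_def
proof (rule runs_Seq, rule runs_loopfreeI)
  let ?m = "sem (Block [LoadC 14 0, LoadC 16 0, Add 16 16 0]) m"
  let ?B = "2 * days I + 48"
  have "base_rep I m" using assms(1) by (simp add: rep_def)
  hence "base_rep I ?m" by (rule base_rep_cong) auto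
  hence "rep I (fst s, False) ?m" using assms(1) by (simp add: rep_def)
  moreover have "?m 16 = int (days I)" using assms(1) by (simp add: rep_def base_rep_def)
  ultimately show "rep I (fst s, False) ?m \<and> ?m 16 = int (days I) \<and> ?m 15 = int (Suc k)"
    using assms(2) by simp
next
  fix m assume m: "rep I (fst s, False) m \<and> m 16 = int (days I) \<and> m 15 = int (Suc k)"
  define s1 where "s1 = fold relax (concat (map (day_edges I) (rev [1..<Suc (days I)]))) (fst s, False)"
  have day: "runs (WhilePos 16 day_com) m (days I * 102 + 1) (\<lambda>m'. rep I s1 m' \<and> m' 15 = int (Suc k))"
    unfolding s1_def using m by (intro runs_day_loop) auto
  show "runs (WhilePos 16 day_com ;; (Block [Add 17 9 0] ;; relax_com 9 17 11 ;; relax_com 17 9 12 ;;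
    Block [Sub 15 15 8])) m (days I * 102 + 1 + 20) (\<lambda>m'. rep I (bf_round (edges I) s) m' \<and> m' 15 = int k)"
  proof (rule runs_Seq[OF day])
    fix m assume m: "rep I s1 m \<and> m 15 = int (Suc k)"
    let ?D = "days I" and ?B = "2 * days I + 48"
    have regs: "m 9 = int ?B" "m 8 = 1" "m 0 = int ?D" if "rep I s m" for s m
      using that by (auto simp: rep_def base_rep_def)
    define m1 where "m1 = sem (Block [Add 17 9 0]) m"
    have rep1: "rep I s1 m1" by (rule rep_cong[OF conjunct1[OF m]]) (auto simp: m1_def)
    have m1: "m1 15 = int (Suc k)" "m1 17 = int (?B + ?D)" "m1 9 = int (?B + 0)"
      using m regs[of s1 m] regs[OF rep1] by (auto simp: m1_def)
    define s2 m2 where "s2 = relax (0, ?D, int (workers I * min (Uw I) ?D)) s1" and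
      "m2 = sem (relax_com 9 17 11) m1"
    have m2: "rep I s2 m2" "m2 15 = int (Suc k)" "m2 17 = int (?B + ?D)"
      using rep_relax_com[OF rep1 m1(3,2), of 11] rep1 m1 by (auto simp: m2_def s2_def rep_def)
    define s3 m3 where "s3 = relax (?D, 0, - int (workers I * (?D - Uo I))) s2" and
      "m3 = sem (relax_com 17 9 12) m2"
    have m3: "rep I s3 m3" "m3 15 = int (Suc k)"
    proof -
      have "m2 9 = int (?B + 0)" "m2 12 = - int (workers I * (?D - Uo I))"
        using m2(1) regs[OF m2(1)] by (simp_all add: rep_def)
      note relax = rep_relax_com[OF m2(1,3) this(1) _ _ this(2)]
      show "rep I s3 m3" unfolding m3_def s3_def by (rule relax) auto
      show "m3 15 = int (Suc k)" unfolding m3_def m2(2)[symmetric] by (rule relax) auto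
    qed
    define m4 where "m4 = sem (Block [Sub 15 15 8]) m3"
    have "rep I s3 m4" by (rule rep_cong[OF m3(1)]) (auto simp: m4_def)
    moreover have "m4 15 = int k" using m3(2) regs[OF m3(1)] by (simp add: m4_def)
    moreover have "bf_round (edges I) s = s3"
      by (simp add: bf_round_def edges_def s3_def s2_def s1_def del: upt_Suc)
    moreover have "sem (Block [Add 17 9 0] ;; relax_com 9 17 11 ;; relax_com 17 9 12 ;; Block [Sub 15 15 8]) m = m4"
      unfolding m4_def m3_def m2_def m1_def by (simp only: sem.simps(2))
    moreover have "loopfree (relax_com u v w)" "clen (relax_com u v w) = 7" for u v w
      by (simp_all add: relax_com_def)
    ultimately show "runs (Block [Add 17 9 0] ;; relax_com 9 17 11 ;; relax_com 17 9 12 ;; Block [Sub 15 15 8])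
        m 20 (\<lambda>m'. rep I (bf_round (edges I) s) m' \<and> m' 15 = int k)"
      by (intro runs_loopfreeI) (simp_all del: sem.simps)
  qed
qed auto

section \<open>Set-up and total running time\<close>

lemma stash_eff:
  assumes "m 2 = int b" "24 \<le> b" "8 \<le> n" "n \<le> 24" "a \<noteq> 4"
  shows "fold eff (stash n) m a = (if b + 8 \<le> a \<and> a < b + n then m (a - b) else m a)"
  using assms(3,4,5)
proof (induction n arbitrary: a rule: nat_induct_at_least)
  case base
  thus ?case by (simp add: stash_def)
next
  case (Suc n)
  let ?m = "fold eff (stash n) m"
  \<comment> \<open>By \<open>24 \<le> b\<close> all targets so far lie at 32 or above, so cell
    \<open>n\<close> and register 2 are intact.\<close>
  have m: "?m n = m n" "?m 2 = int b" using Suc assms by (auto simp: Suc.IH)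
  have "fold eff (stash (Suc n)) m = fold eff [LoadC 4 (int n), Add 4 4 2, StoreI 4 n] ?m"
    using Suc.hyps by (simp add: stash_def)
  also have "\<dots> = ?m(4 := int (n + b), n + b := m n)" using m Suc.hyps by (simp add: nat_add_distrib)
  finally show ?case using Suc assms(2) by auto
qed

lemma runs_min_com:
  assumes "r \<notin> {0, 4, 16}" "m 0 = int x" "m r = int y"
  shows "runs (min_com r) m 5 (\<lambda>m'. m' 16 = int (min y x) \<and> (\<forall>a. a \<notin> {4, 16} \<longrightarrow> m' a = m a))"
  using assms by (intro runs_loopfreeI) (auto simp: min_com_def)

lemma runs_mult_com:
  assumes "r \<notin> {8, 16, s}" "s \<noteq> 16" "m 8 = 1" "m 16 \<le> int x"
  shows "runs (mult_com r s) m (4 * x + 2)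
    (\<lambda>m'. m' r = int (nat (m 16)) * m s \<and> (\<forall>a. a \<notin> {r, 16} \<longrightarrow> m' a = m a))"
proof -
  define n where "n = nat (m 16)"
  \<comment> \<open>\<open>nat\<close> covers a negative counter, for which the loop is left at
    once.\<close>
  define Inv where "Inv k m' \<longleftrightarrow> k \<le> n \<and> nat (m' 16) = k \<and> m' r = int (n - k) * m s \<and>
    (\<forall>a. a \<notin> {r, 16} \<longrightarrow> m' a = m a)" for k m'
  have init: "runs (Block [LoadC r 0]) m 1 (\<lambda>m'. m' = m(r := 0))"
    by (rule runs_loopfreeI) auto
  have loop: "runs (WhilePos 16 (Block [Add r r s, Sub 16 16 8])) (m(r := 0)) (n * (2 + 2) + 1) (Inv 0)"
  proof (rule runs_WhilePos)
    show "Inv n (m(r := 0))" using assms by (simp add: Inv_def n_def)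
  next
    fix k m' assume m': "Inv (Suc k) m'"
    have "m' s = m s" "m' 8 = 1" using m' assms by (auto simp: Inv_def)
    moreover have "int (n - k) = int (n - Suc k) + 1" using m' by (simp add: Inv_def)
    ultimately have "Inv k (sem (Block [Add r r s, Sub 16 16 8]) m')"
      using m' assms by (auto simp: Inv_def algebra_simps)
    moreover have "0 < m' 16" using m' by (auto simp: Inv_def)
    ultimately show "0 < m' 16 \<and> runs (Block [Add r r s, Sub 16 16 8]) m' 2 (Inv k)"
      by (intro conjI runs_loopfreeI) auto
  qed (simp add: Inv_def)
  have "runs (mult_com r s) m (1 + (n * (2 + 2) + 1)) (Inv 0)"
    unfolding mult_com_def by (rule runs_Seq[OF init]) (simp only: loop)
  thus ?thesis by (rule runs_mono) (use assms(4) in \<open>auto simp: Inv_def n_def\<close>)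
qed

lemma runs_setup_com:
  assumes "udodosp_inst I"
  shows "runs setup_com (encode I) (12 * days I + 80)
    (\<lambda>m. rep I (\<lambda>_. 0, False) m \<and> m 15 = int (days I + 2))"
proof -
  let ?D = "days I" and ?N = "workers I"
  \<comment> \<open>\<open>G\<close> is the initial \<open>rep\<close> without weights and flag; the
    potentials are 0 because their cells lie beyond the input and its moved copy.\<close>
  define G where "G m \<longleftrightarrow> base_rep I m \<and> (\<forall>k\<le>?D. m (2 * ?D + 48 + k) = 0)" for m
  have G_cong: "G m'" if "G m" "\<And>a. a \<notin> {4, 10, 11, 12} \<union> {14..22} \<Longrightarrow> m' a = m a" for m m'
  proof -
    have "base_rep I m" using that(1) by (simp add: G_def)
    hence "base_rep I m'" by (rule base_rep_cong) (rule that(2))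
    thus ?thesis using that by (simp add: G_def)
  qed
  have G_frame: "G m'" if "G m" "\<forall>a. a \<noteq> r \<and> a \<noteq> 16 \<longrightarrow> m' a = m a" "r \<in> {4, 10, 11, 12}" for m m' r
    using that(2,3) by (intro G_cong[OF that(1)]) auto
  have G_regs: "m 0 = int ?D" "m (Suc 0) = int ?N" "m 3 = int (uw I)" "m 6 = int (Uw I)"
    "m 7 = int (Uo I)" "m 8 = 1" "m 13 = - int ?N" if "G m" for m
    using that by (auto simp: G_def base_rep_def)
  define P1 where "P1 m \<longleftrightarrow> G m \<and> m 16 = int (min (uw I) ?D)" for m
  define P2 where "P2 m \<longleftrightarrow> G m \<and> m 10 = int (?N * min (uw I) ?D)" for m
  define P3 where "P3 m \<longleftrightarrow> P2 m \<and> m 16 = int (min (Uw I) ?D)" for m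
  define P4 where "P4 m \<longleftrightarrow> P2 m \<and> m 11 = int (?N * min (Uw I) ?D)" for m
  define P5 where "P5 m \<longleftrightarrow> P4 m \<and> m 16 = int ?D - int (Uo I)" for m
  define P6 where "P6 m \<longleftrightarrow> P4 m \<and> m 12 = - int (?N * (?D - Uo I))" for m
  have r0: "runs (Block [Add 2 0 0, LoadC 4 24, Add 2 2 4] ;; Block (stash 24) ;;
      Block [LoadC 8 1, LoadC 23 24, Add 9 2 23, LoadC 13 0, Sub 13 13 1]) (encode I) 60 G"
  proof (rule runs_loopfreeI)
    define m where "m = sem (Block [Add 2 0 0, LoadC 4 24, Add 2 2 4]) (encode I)"
    have m: "m 2 = int (2 * ?D + 24)" and m': "\<And>a. a \<notin> {2, 4} \<Longrightarrow> m a = encode I a"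
      by (auto simp: m_def encode_def)
    define m1 where "m1 = fold eff (stash 24) m"
    have m1: "m1 a = (if 2 * ?D + 24 + 8 \<le> a \<and> a < 2 * ?D + 24 + 24 then encode I (a - (2 * ?D + 24))
        else if a = 2 then int (2 * ?D + 24) else encode I a)" if "a \<noteq> 4" for a
      using stash_eff[of m "2 * ?D + 24" 24 a, OF m] that m
      by (auto simp: m1_def intro!: m')
    define m2 where "m2 = m1(8 := 1, 23 := 24, 9 := int (2 * ?D + 48), 13 := - int ?N)"
    have "G m2" unfolding G_def base_rep_def by (auto simp: m2_def m1 encode_def)
    moreover have "sem (Block [LoadC 8 1, LoadC 23 24, Add 9 2 23, LoadC 13 0, Sub 13 13 1]) m1 = m2"
      using m1[of 2] m1[of 1] by (simp add: m2_def encode_def add.commute)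
    ultimately show "G (sem (Block [Add 2 0 0, LoadC 4 24, Add 2 2 4] ;; Block (stash 24) ;;
        Block [LoadC 8 1, LoadC 23 24, Add 9 2 23, LoadC 13 0, Sub 13 13 1]) (encode I))"
      by (simp only: m1_def m_def sem.simps(1,2))
  qed (simp_all add: stash_def upt_rec)
  have r1: "runs (min_com 3) m 5 P1" if "G m" for m
    by (rule runs_mono[OF runs_min_com[of 3 m ?D "uw I"]])
       (use that in \<open>auto simp: G_regs P1_def intro: G_frame[of m]\<close>)
  have r2: "runs (mult_com 10 1) m (4 * ?D + 2) P2" if "P1 m" for m
    by (rule runs_mono[OF runs_mult_com[of 10 1 m ?D]])
       (use that in \<open>auto simp: G_regs P1_def P2_def intro: G_frame[of m]\<close>)
  have r3: "runs (min_com 6) m 5 P3" if "P2 m" for m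
    by (rule runs_mono[OF runs_min_com[of 6 m ?D "Uw I"]])
       (use that in \<open>auto simp: G_regs P2_def P3_def intro: G_frame[of m]\<close>)
  have r4: "runs (mult_com 11 1) m (4 * ?D + 2) P4" if "P3 m" for m
    by (rule runs_mono[OF runs_mult_com[of 11 1 m ?D]])
       (use that in \<open>auto simp: G_regs P2_def P3_def P4_def intro: G_frame[of m]\<close>)
  have r5: "runs (Block [Sub 16 0 7]) m 1 P5" if "P4 m" for m
    by (rule runs_loopfreeI) (use that in \<open>auto simp: G_regs P2_def P4_def P5_def intro: G_frame[of m]\<close>)
  have r6: "runs (mult_com 12 13) m (4 * ?D + 2) P6" if "P5 m" for m
    by (rule runs_mono[OF runs_mult_com[of 12 13 m ?D]])
       (use that in \<open>auto simp: G_regs P2_def P4_def P5_def P6_def nat_diff_distrib' intro: G_frame[of m]\<close>)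
  have r7: "runs (Block [LoadC 14 0, LoadC 15 2, Add 15 15 0]) m 3
      (\<lambda>m. rep I (\<lambda>_. 0, False) m \<and> m 15 = int (?D + 2))" if "P6 m" for m
  proof (rule runs_loopfreeI)
    let ?m = "sem (Block [LoadC 14 0, LoadC 15 2, Add 15 15 0]) m"
    have "G m" using that by (simp add: P6_def P4_def P2_def)
    hence "G ?m" by (rule G_cong) auto
    thus "rep I (\<lambda>_. 0, False) ?m \<and> ?m 15 = int (?D + 2)"
      using that G_regs[OF \<open>G m\<close>] by (simp add: rep_def G_def P6_def P4_def P2_def)
  qed auto
  show ?thesis unfolding setup_com_def
    by (rule runs_mono[OF runs_Seq[OF r0 runs_Seq[OF r1 runs_Seq[OF r2 runs_Seq[OF r3
      runs_Seq[OF r4 runs_Seq[OF r5 runs_Seq[OF r6 r7]]]]]]]]) auto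
qed

lemma runs_main_com:
  assumes I: "udodosp_inst I"
  shows "runs main_com (encode I) (2000 * days I ^ 2)
    (\<lambda>m. m 0 = (if has_feasible_schedule I then 1 else 0))"
proof -
  let ?D = "days I" and ?t = "3 + (days I * 102 + 1 + 20)"
  define s where "s k = (bf_round (edges I) ^^ k) (\<lambda>_. 0, False)" for k
  define Inv where "Inv k m \<longleftrightarrow> k \<le> ?D + 2 \<and> rep I (s (?D + 2 - k)) m \<and> m 15 = int k" for k m
  have init: "runs setup_com (encode I) (12 * ?D + 80) (Inv (?D + 2))"
    by (rule runs_mono[OF runs_setup_com[OF I]]) (auto simp: Inv_def s_def)
  have loop: "runs (WhilePos 15 round_com) m ((?D + 2) * (?t + 2) + 1) (Inv 0)"
    if "Inv (?D + 2) m" for m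
  proof (rule runs_WhilePos)
    fix k m assume m: "Inv (Suc k) m"
    have "?D + 2 - k = Suc (?D + 2 - Suc k)" using m by (auto simp: Inv_def)
    hence "s (?D + 2 - k) = bf_round (edges I) (s (?D + 2 - Suc k))" by (simp add: s_def)
    moreover have "runs round_com m ?t (\<lambda>m'. rep I (bf_round (edges I) (s (?D + 2 - Suc k))) m' \<and> m' 15 = int k)"
      by (rule runs_round_com) (use m in \<open>auto simp: Inv_def\<close>)
    ultimately have "runs round_com m ?t (Inv k)"
      by (elim runs_mono) (use m in \<open>auto simp: Inv_def\<close>)
    thus "0 < m 15 \<and> runs round_com m ?t (Inv k)" using m by (simp add: Inv_def)
  qed (use that in \<open>auto simp: Inv_def\<close>)
  have flag: "snd (s (?D + 2)) \<longleftrightarrow> \<not> has_feasible_schedule I"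
    unfolding s_def has_feasible_schedule_iff_sat[OF I]
    by (rule bellman_ford[OF _ edges_vertices]) auto
  have out: "runs (Block [Sub 0 8 14]) m 1 (\<lambda>m. m 0 = (if has_feasible_schedule I then 1 else 0))"
    if "Inv 0 m" for m
    by (rule runs_loopfreeI) (use that flag in \<open>auto simp: Inv_def rep_def base_rep_def\<close>)
  have "1 \<le> ?D" using I by (simp add: udodosp_inst_def valid_inst_def)
  \<comment> \<open>\<open>1 \<le> ?D\<close> absorbs the lower-order terms: 102 + 242 + 134 = 478
    is well below 2000.\<close>
  hence "1 \<le> ?D ^ 2" "?D \<le> ?D ^ 2" by (auto simp: power2_eq_square)
  moreover have "12 * ?D + 80 + ((?D + 2) * (?t + 2) + 1 + 1) = 102 * ?D ^ 2 + 242 * ?D + 134"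
    by (simp add: power2_eq_square algebra_simps)
  ultimately have t: "12 * ?D + 80 + ((?D + 2) * (?t + 2) + 1 + 1) \<le> 2000 * ?D ^ 2"
    by linarith
  show ?thesis unfolding main_com_def
    by (rule runs_mono[OF runs_Seq[OF init runs_Seq[OF loop out]] t])
qed

theorem theorem4p1:
  "\<exists>P (c::nat). decides_within P udodosp_inst has_feasible_schedule (\<lambda>I. c * days I ^ 2)"
proof (intro exI)
  show "decides_within (compile main_com 0) udodosp_inst has_feasible_schedule (\<lambda>I. 2000 * days I ^ 2)"
    unfolding decides_within_def
  proof (intro allI impI)
    fix I assume "udodosp_inst I"
    \<comment> \<open>With no surrounding code the program ends just past its last instruction,
      which counts as halted.\<close>
    from runs_main_com[OF this, unfolded runs_def, rule_format, of "[]" "[]"]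
    obtain t m where "t \<le> 2000 * days I ^ 2" "exec (compile main_com 0) t (0, encode I) = (clen main_com, m)"
      "m 0 = (if has_feasible_schedule I then 1 else 0)" by auto
    thus "\<exists>t\<le>2000 * days I ^ 2. halted (compile main_com 0) (exec (compile main_com 0) t (0, encode I)) \<and>
        snd (exec (compile main_com 0) t (0, encode I)) 0 = (if has_feasible_schedule I then 1 else 0)"
      by (intro exI[of _ t]) (simp add: halted_def)
  qed
qed

end
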